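(* Let $\mathbf{X}\in\mathbb{R}^{N\times d}$, $\mathbf{F}\in\mathbb{R}^{N\times k}$ and $\gamma>0$ be fixed, and consider the problem $$\min_{\mathbf{P}\in\mathbb{R}^{d\times k}}\ J(\mathbf{P})=\|\mathbf{X}\mathbf{P}-\mathbf{F}\|_F^2+\gamma\|\mathbf{P}\|_{2,1}.$$ The iterative optimization process for solving this problem, which alternates between computing the diagonal matrix $\boldsymbol{\Gamma}=\boldsymbol{\Gamma}(\mathbf{P})$ from the current $\mathbf{P}$ and replacing $\mathbf{P}$ by $$\widehat{\mathbf{P}}=(\mathbf{X}^{T}\mathbf{X}+\gamma\boldsymbol{\Gamma})^{-1}\mathbf{X}^{T}\mathbf{F},$$ monotonically decreases the objective function value $J$ until convergence. That is, if $\widehat{\mathbf{P}}$ is the update obtained from $\mathbf{P}$, then $$\|\mathbf{X}\widehat{\mathbf{P}}-\mathbf{F}\|_F^2+\gamma\|\widehat{\mathbf{P}}\|_{2,1}\le\|\mathbf{X}\mathbf{P}-\mathbf{F}\|_F^2+\gamma\|\mathbf{P}\|_{2,1}.$$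
   Context: For $\mathbf{P}\in\mathbb{R}^{d\times k}$, $\mathbf{P}_{i'}$ denotes its $i$-th row (written as a row vector), and $\|\mathbf{P}\|_{2,1}=\sum_{i=1}^d\|\mathbf{P}_{i'}\|_2$ is the $l_{2,1}$ norm; $\|\cdot\|_F$ is the Frobenius norm. $\boldsymbol{\Gamma}(\mathbf{P})\in\mathbb{R}^{d\times d}$ is the diagonal matrix whose $i$-th diagonal entry is $\dfrac{1}{2\sqrt{\mathbf{P}_{i'}\mathbf{P}_{i'}^{T}}+\epsilon}$, where $\epsilon>0$ is a small enough constant, used to avoid division by zero when $\|\mathbf{P}_{i'}\|_2=0$. For fixed $\boldsymbol{\Gamma}$, the update $\widehat{\mathbf{P}}$ is obtained by setting to zero the derivative of $\|\mathbf{X}\mathbf{P}-\mathbf{F}\|_F^2+\gamma\,\mathrm{Tr}(\mathbf{P}^{T}\boldsymbol{\Gamma}\mathbf{P})$ with respect to $\mathbf{P}$. The process repeats the two steps (fix $\boldsymbol{\Gamma}$ and solve for $\mathbf{P}$, then recompute $\boldsymbol{\Gamma}$) until convergence.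
   Formalization: For fixed ε>0 the inequality fails (X=F=γ=1, P=1/2). Proved instead: descent for the limit update as ε→0+, for ε=0 if no row of P is zero, and for the first n steps with all ε>0 small depending on X,F,γ,P,n, while the ε→0+ process is not stationary. *)

theory Defs
  imports "HOL-Analysis.Analysis"
begin

definition l21_norm :: "real^'k^'d \<Rightarrow> real" where
  "l21_norm P = (\<Sum>i\<in>UNIV. norm (row i P))"

text \<open>The library norm on \<open>real^'k^'n\<close> is the Euclidean norm of the vector of row norms, that is,
  the Frobenius norm.\<close>

definition objective :: "real^'d^'n \<Rightarrow> real^'k^'n \<Rightarrow> real \<Rightarrow> real^'k^'d \<Rightarrow> real" where
  "objective X F \<gamma> P = (norm (X ** P - F))\<^sup>2 + \<gamma> * l21_norm P"

definition Gamma_mat :: "real \<Rightarrow> real^'k^'d \<Rightarrow> real^'d^'d" where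
  "Gamma_mat \<epsilon> P =
     (\<chi> i j. if i = j then 1 / (2 * sqrt (row i P \<bullet> row i P) + \<epsilon>) else 0)"

definition system_mat :: "real^'d^'n \<Rightarrow> real \<Rightarrow> real \<Rightarrow> real^'k^'d \<Rightarrow> real^'d^'d" where
  "system_mat X \<gamma> \<epsilon> P = transpose X ** X + \<gamma> *\<^sub>R Gamma_mat \<epsilon> P"

definition update ::
  "real^'d^'n \<Rightarrow> real^'k^'n \<Rightarrow> real \<Rightarrow> real \<Rightarrow> real^'k^'d \<Rightarrow> real^'k^'d" where
  "update X F \<gamma> \<epsilon> P = matrix_inv (system_mat X \<gamma> \<epsilon> P) ** (transpose X ** F)"

text \<open>The constant \<open>\<epsilon>\<close> only serves to avoid a division by zero at zero rows, but any fixed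
  \<open>\<epsilon> > 0\<close> displaces the fixed points of the update slightly from the minimiser of the
  objective. If \<open>X\<close>, \<open>F\<close> and \<open>\<gamma>\<close> are the scalar \<open>1\<close>, the minimiser is \<open>P = 1/2\<close>, and one update
  moves it to \<open>(1 + \<epsilon>) / (2 + \<epsilon>)\<close>, so the objective strictly increases there for every
  \<open>\<epsilon> > 0\<close>. ``Small enough'' is therefore understood in the sense \<open>\<epsilon> \<rightarrow> 0+\<close>. The update
  idealised in this sense is the following limit, which makes sense also when \<open>P\<close> has zero rows.\<close>

definition limit_update ::
  "real^'d^'n \<Rightarrow> real^'k^'n \<Rightarrow> real \<Rightarrow> real^'k^'d \<Rightarrow> real^'k^'d" where
  "limit_update X F \<gamma> P = Lim (at_right 0) (\<lambda>\<epsilon>. update X F \<gamma> \<epsilon> P)"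

end

theory Submission
  imports Defs
begin

text \<open>Write \<open>W\<close> for the diagonal matrix with entries \<open>w\<^sub>i = 2 \<parallel>P\<^sub>i\<parallel> + \<epsilon>\<close>, the inverse of \<open>\<Gamma>\<close>.
  By the push-through identity
  \<open>(X\<^sup>T X + \<gamma> W\<^sup>-\<^sup>1) W X\<^sup>T = X\<^sup>T (X W X\<^sup>T + \<gamma> I)\<close>, the update equals
  \<open>W X\<^sup>T (X W X\<^sup>T + \<gamma> I)\<^sup>-\<^sup>1 F\<close>. This form makes sense and is continuous for all \<open>w \<ge> 0\<close>, so it
  gives the limit \<open>\<epsilon> \<rightarrow> 0+\<close>, zero rows included, and the convergence of the iterates.
  The limit update \<open>Q\<close> of \<open>P\<close> satisfies \<open>Q\<^sub>i = 2 \<parallel>P\<^sub>i\<parallel> Y\<^sub>i\<close> and \<open>X\<^sup>T (F - X Q) = \<gamma> Y\<close> for some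
  \<open>Y\<close>; expanding the square around \<open>Q\<close> then yields descent, strict unless \<open>Q = P\<close>. Strictness
  at a point of the limiting iteration survives small perturbations of \<open>\<epsilon>\<close>.\<close>

section \<open>Matrices\<close>

lemma matrix_inv_inverse:
  fixes A :: "'a::semiring_1^'n^'m"
  assumes "invertible A"
  shows "A ** matrix_inv A = mat 1" "matrix_inv A ** A = mat 1"
proof -
  have "A ** matrix_inv A = mat 1 \<and> matrix_inv A ** A = mat 1"
    unfolding matrix_inv_def using assms unfolding invertible_def by (rule someI_ex)
  then show "A ** matrix_inv A = mat 1" "matrix_inv A ** A = mat 1" by auto
qed

lemma invertible_if_positive_definite:
  fixes A :: "real^'n^'n"
  assumes "\<And>v. v \<noteq> 0 \<Longrightarrow> v \<bullet> (A *v v) > 0"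
  shows "invertible A"
proof -
  have "v = 0" if "A *v v = 0" for v
    using assms[of v] that by fastforce
  then show ?thesis
    by (simp add: invertible_left_inverse matrix_left_invertible_ker)
qed

lemma inner_transpose_mult:
  fixes A :: "real^'m^'n"
  shows "u \<bullet> (transpose A *v v) = (A *v u) \<bullet> v"
  by (metis dot_lmul_matrix inner_commute transpose_matrix_vector)

text \<open>The inner product of \<open>real^'k^'n\<close> is the Frobenius one, and left
  multiplication by \<open>transpose A\<close> is the adjoint of left multiplication by
  \<open>A\<close>.\<close>

lemma inner_matrix_mult:
  fixes A :: "real^'m^'n" and B :: "real^'k^'m" and C :: "real^'k^'n"
  shows "(A ** B) \<bullet> C = B \<bullet> (transpose A ** C)"
proof -
  have "(A ** B) \<bullet> C = (\<Sum>i\<in>UNIV. \<Sum>j\<in>UNIV. \<Sum>l\<in>UNIV. A $ i $ l * B $ l $ j * C $ i $ j)"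
    by (simp add: inner_vec_def matrix_matrix_mult_def sum_distrib_right)
  also have "\<dots> = (\<Sum>i\<in>UNIV. \<Sum>l\<in>UNIV. \<Sum>j\<in>UNIV. A $ i $ l * B $ l $ j * C $ i $ j)"
    by (intro sum.cong refl sum.swap)
  also have "\<dots> = (\<Sum>l\<in>UNIV. \<Sum>i\<in>UNIV. \<Sum>j\<in>UNIV. A $ i $ l * B $ l $ j * C $ i $ j)"
    by (rule sum.swap)
  also have "\<dots> = (\<Sum>l\<in>UNIV. \<Sum>j\<in>UNIV. \<Sum>i\<in>UNIV. A $ i $ l * B $ l $ j * C $ i $ j)"
    by (intro sum.cong refl sum.swap)
  also have "\<dots> = B \<bullet> (transpose A ** C)"
    by (simp add: inner_vec_def matrix_matrix_mult_def transpose_def sum_distrib_left mult_ac)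
  finally show ?thesis .
qed

lemma matrix_add_rdistrib:
  "(A + B) ** C = A ** C + B ** (C :: 'a::semiring_1^'k^'m)"
  by (simp add: matrix_matrix_mult_def vec_eq_iff sum.distrib distrib_right)

lemma matrix_diff_ldistrib:
  "A ** (B - C) = A ** B - A ** (C :: 'a::ring_1^'k^'m)"
  by (simp add: matrix_matrix_mult_def vec_eq_iff sum_subtractf right_diff_distrib)

lemma tendsto_matrix_mult [tendsto_intros]:
  fixes A :: "'a \<Rightarrow> real^'m^'n" and B :: "'a \<Rightarrow> real^'k^'m"
  assumes "(A \<longlongrightarrow> A0) G" "(B \<longlongrightarrow> B0) G"
  shows "((\<lambda>x. A x ** B x) \<longlongrightarrow> A0 ** B0) G"
  unfolding matrix_matrix_mult_def by (intro tendsto_intros assms)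

lemma tendsto_det [tendsto_intros]:
  fixes A :: "'a \<Rightarrow> real^'n^'n"
  assumes "(A \<longlongrightarrow> A0) G"
  shows "((\<lambda>x. det (A x)) \<longlongrightarrow> det A0) G"
  unfolding det_def by (intro tendsto_intros assms)

text \<open>Column \<open>l\<close> of the inverse solves \<open>A *v x = axis l 1\<close>. Cramer's
  rule thus writes every entry as a quotient of determinants, from which continuity of the inverse
  can be read off.\<close>

lemma matrix_inv_cramer:
  fixes A :: "real^'n^'n"
  assumes "det A \<noteq> 0"
  shows "matrix_inv A =
    (\<chi> k l. det (\<chi> i j. if j = k then axis l 1 $ i else A $ i $ j) / det A)"
proof -
  have "invertible A" using assms by (simp add: invertible_det_nz)
  have "matrix_inv A *v axis l 1 =
    (\<chi> k. det (\<chi> i j. if j = k then axis l 1 $ i else A $ i $ j) / det A)" for l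
    using cramer[OF assms, of "matrix_inv A *v axis l 1" "axis l 1"]
    by (simp add: matrix_vector_mul_assoc matrix_inv_inverse[OF \<open>invertible A\<close>])
  then have "matrix_inv A $ k $ l =
    det (\<chi> i j. if j = k then axis l 1 $ i else A $ i $ j) / det A" for k l
    by (metis (no_types, lifting) column_def matrix_vector_mult_basis vec_lambda_beta)
  then show ?thesis by (simp add: vec_eq_iff)
qed

lemma tendsto_matrix_inv:
  fixes A :: "'a \<Rightarrow> real^'n^'n"
  assumes A: "(A \<longlongrightarrow> A0) G" and "invertible A0"
  shows "((\<lambda>x. matrix_inv (A x)) \<longlongrightarrow> matrix_inv A0) G"
proof -
  have det: "det A0 \<noteq> 0" using assms by (simp add: invertible_det_nz)
  have "((\<lambda>x. if j = k then axis l 1 $ i else A x $ i $ j) \<longlongrightarrow>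
      (if j = k then axis l 1 $ i else A0 $ i $ j)) G" for i j k l
    using A by (auto intro!: tendsto_intros)
  then have "((\<lambda>x. \<chi> k l. det (\<chi> i j. if j = k then axis l 1 $ i else A x $ i $ j) / det (A x))
      \<longlongrightarrow> matrix_inv A0) G"
    unfolding matrix_inv_cramer[OF det] by (intro tendsto_intros A det)
  moreover have "\<forall>\<^sub>F x in G. det (A x) \<noteq> 0"
    using tendsto_imp_eventually_ne[OF tendsto_det[OF A] det] .
  ultimately show ?thesis
    by (elim Lim_transform_eventually eventually_mono) (rule matrix_inv_cramer[symmetric])
qed

definition diag_mat :: "'a::zero^'n \<Rightarrow> 'a^'n^'n" where
  "diag_mat w = (\<chi> i j. if i = j then w $ i else 0)"

lemma diag_mat_mult_vec [simp]:
  fixes w :: "real^'n"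
  shows "(diag_mat w *v v) $ i = w $ i * v $ i"
  by (simp add: diag_mat_def matrix_vector_mult_def if_distrib[where f="\<lambda>x. x * _"] cong: if_cong)

lemma diag_mat_mult [simp]:
  fixes w :: "real^'n" and A :: "real^'k^'n"
  shows "(diag_mat w ** A) $ i = w $ i *\<^sub>R A $ i"
  by (simp add: vec_eq_iff diag_mat_def matrix_matrix_mult_def
      if_distrib[where f="\<lambda>x. x * _"] cong: if_cong)

lemma tendsto_diag_mat [tendsto_intros]:
  fixes w :: "'a \<Rightarrow> real^'n"
  assumes "(w \<longlongrightarrow> w0) G"
  shows "((\<lambda>x. diag_mat (w x)) \<longlongrightarrow> diag_mat w0) G"
proof -
  have "((\<lambda>x. if i = j then w x $ i else 0) \<longlongrightarrow> (if i = j then w0 $ i else 0)) G" for i j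
    using assms by (auto intro!: tendsto_intros)
  then show ?thesis unfolding diag_mat_def by (intro tendsto_intros)
qed

section \<open>The dual form of the update\<close>

definition dual_mat :: "real^'d^'n \<Rightarrow> real \<Rightarrow> real^'d \<Rightarrow> real^'n^'n" where
  "dual_mat X \<gamma> w = X ** (diag_mat w ** transpose X) + \<gamma> *\<^sub>R mat 1"

definition dual_update :: "real^'d^'n \<Rightarrow> real^'k^'n \<Rightarrow> real \<Rightarrow> real^'d \<Rightarrow> real^'k^'d" where
  "dual_update X F \<gamma> w = diag_mat w ** (transpose X ** (matrix_inv (dual_mat X \<gamma> w) ** F))"

definition weights :: "real \<Rightarrow> real^'k^'d \<Rightarrow> real^'d" where
  "weights \<epsilon> P = (\<chi> i. 2 * norm (row i P) + \<epsilon>)"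

lemma row_eq_nth: "row i A = A $ i"
  by (simp add: row_def)

lemma inner_diag_mat_nonneg:
  fixes w :: "real^'n"
  assumes "\<And>i. w $ i \<ge> 0"
  shows "v \<bullet> (diag_mat w *v v) \<ge> 0"
  unfolding inner_vec_def
  by (auto intro!: sum_nonneg mult_nonneg_nonneg[OF assms] simp: mult.left_commute[of "v $ _" "w $ _"])

text \<open>The quadratic form at \<open>v\<close> is that of \<open>diag_mat w\<close> at
  \<open>transpose X *v v\<close>, which is nonnegative, plus \<gamma> times the squared norm of
  \<open>v\<close>.\<close>

lemma invertible_dual_mat:
  fixes X :: "real^'d^'n"
  assumes "\<gamma> > 0" and "\<And>i. w $ i \<ge> 0"
  shows "invertible (dual_mat X \<gamma> w)"
proof (rule invertible_if_positive_definite)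
  fix v :: "real^'n" assume "v \<noteq> 0"
  let ?u = "transpose X *v v"
  have "v \<bullet> (X *v (diag_mat w *v ?u)) = ?u \<bullet> (diag_mat w *v ?u)"
    using inner_transpose_mult[of v "transpose X"] by (simp add: transpose_transpose)
  then have "v \<bullet> (dual_mat X \<gamma> w *v v) = ?u \<bullet> (diag_mat w *v ?u) + \<gamma> * (v \<bullet> v)"
    by (simp add: dual_mat_def matrix_vector_mult_add_rdistrib inner_add_right
        matrix_vector_mul_assoc[symmetric] scaleR_matrix_vector_assoc[symmetric])
  moreover have "v \<bullet> v > 0" using \<open>v \<noteq> 0\<close> by simp
  ultimately show "v \<bullet> (dual_mat X \<gamma> w *v v) > 0"
    using inner_diag_mat_nonneg[of w ?u] assms by (simp add: add_nonneg_pos)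
qed

text \<open>The limit \<open>w0\<close> may have zero entries: \<open>dual_mat X \<gamma> w0\<close>
  is still invertible because \<gamma> > 0, and inversion is continuous there.\<close>

lemma tendsto_dual_update:
  assumes "\<gamma> > 0" and "\<And>i. w0 $ i \<ge> 0" and "(w \<longlongrightarrow> w0) G"
  shows "((\<lambda>x. dual_update X F \<gamma> (w x)) \<longlongrightarrow> dual_update X F \<gamma> w0) G"
  unfolding dual_update_def
  by (intro tendsto_intros tendsto_matrix_inv invertible_dual_mat assms)
    (unfold dual_mat_def, intro tendsto_intros assms)

text \<open>The residual \<open>F - X ** Q\<close> of the dual update \<open>Q\<close> is \<gamma>
  times \<open>?Z\<close>, and \<open>Y\<close> is \<open>transpose X ** ?Z\<close>. Row
  \<open>i\<close> of \<open>Y\<close> stands in for the quotient of row \<open>i\<close> of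
  \<open>Q\<close> by \<open>w $ i\<close>, and stays meaningful when that weight is 0.\<close>

lemma dual_update_stationary:
  assumes "\<gamma> > 0" and "\<And>i. w $ i \<ge> 0"
  obtains Y where "dual_update X F \<gamma> w = diag_mat w ** Y"
    and "transpose X ** (F - X ** dual_update X F \<gamma> w) = \<gamma> *\<^sub>R Y"
proof
  let ?Z = "matrix_inv (dual_mat X \<gamma> w) ** F"
  show Q: "dual_update X F \<gamma> w = diag_mat w ** (transpose X ** ?Z)"
    by (simp add: dual_update_def)
  have "dual_mat X \<gamma> w ** ?Z = F"
    by (simp add: matrix_mul_assoc matrix_inv_inverse[OF invertible_dual_mat[OF assms]])
  then have "X ** dual_update X F \<gamma> w + \<gamma> *\<^sub>R ?Z = F"
    by (simp add: dual_mat_def Q matrix_add_rdistrib matrix_mul_assoc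
        flip: scalar_matrix_assoc)
  then have "F - X ** dual_update X F \<gamma> w = \<gamma> *\<^sub>R ?Z" by (simp add: algebra_simps)
  then show "transpose X ** (F - X ** dual_update X F \<gamma> w) = \<gamma> *\<^sub>R (transpose X ** ?Z)"
    by (simp add: matrix_scalar_ac flip: scalar_matrix_assoc)
qed

section \<open>The update and its limit in dual form\<close>

lemma weights_nth: "weights \<epsilon> P $ i = 2 * norm (P $ i) + \<epsilon>"
  by (simp add: weights_def row_eq_nth)

lemma Gamma_mat_eq: "Gamma_mat \<epsilon> P = diag_mat (\<chi> i. 1 / weights \<epsilon> P $ i)"
  by (simp add: Gamma_mat_def diag_mat_def weights_def norm_eq_sqrt_inner vec_eq_iff)

text \<open>Assuming positive weights covers two cases at once: \<epsilon> > 0 with any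
  \<open>P\<close>, and \<epsilon> = 0 with all rows of \<open>P\<close> nonzero.\<close>

lemma invertible_system_mat:
  fixes X :: "real^'d^'n" and P :: "real^'k^'d"
  assumes "\<gamma> > 0" and pos: "\<And>i. weights \<epsilon> P $ i > 0"
  shows "invertible (system_mat X \<gamma> \<epsilon> P)"
proof (rule invertible_if_positive_definite)
  fix v :: "real^'d" assume "v \<noteq> 0"
  then obtain k where k: "v $ k \<noteq> 0" by (auto simp: vec_eq_iff)
  have "0 < v $ k * (Gamma_mat \<epsilon> P *v v) $ k"
    using k pos[of k] by (simp add: Gamma_mat_eq flip: power2_eq_square)
  then have "0 < v \<bullet> (Gamma_mat \<epsilon> P *v v)"
    unfolding inner_vec_def
    by (intro sum_pos2[of _ k])
      (auto simp: Gamma_mat_eq mult.left_commute intro!: divide_nonneg_nonneg order.strict_implies_order[OF pos])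
  moreover have "v \<bullet> (transpose X *v (X *v v)) = (X *v v) \<bullet> (X *v v)"
    by (rule inner_transpose_mult)
  ultimately show "v \<bullet> (system_mat X \<gamma> \<epsilon> P *v v) > 0"
    using \<open>\<gamma> > 0\<close>
    by (simp add: system_mat_def matrix_vector_mult_add_rdistrib inner_add_right add_nonneg_pos
        matrix_vector_mul_assoc[symmetric] scaleR_matrix_vector_assoc[symmetric])
qed

text \<open>For positive weights \<open>Gamma_mat\<close> inverts
  \<open>diag_mat (weights \<epsilon> P)\<close>, so it maps \<open>?Q\<close> to \<open>Y\<close>.
  The stationarity relation then becomes the linear system that defines the update.\<close>

lemma update_eq_dual_update:
  assumes "\<gamma> > 0" and pos: "\<And>i. weights \<epsilon> P $ i > 0"
  shows "update X F \<gamma> \<epsilon> P = dual_update X F \<gamma> (weights \<epsilon> P)"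
proof -
  let ?Q = "dual_update X F \<gamma> (weights \<epsilon> P)"
  obtain Y where Y: "?Q = diag_mat (weights \<epsilon> P) ** Y"
      "transpose X ** (F - X ** ?Q) = \<gamma> *\<^sub>R Y"
    using dual_update_stationary[OF \<open>\<gamma> > 0\<close> order.strict_implies_order[OF pos]] by blast
  have "Gamma_mat \<epsilon> P ** ?Q = Y"
    unfolding Y(1) using pos by (simp add: vec_eq_iff Gamma_mat_eq less_imp_neq[symmetric])
  then have "system_mat X \<gamma> \<epsilon> P ** ?Q = transpose X ** F"
    using Y(2)
    by (simp add: system_mat_def matrix_add_rdistrib matrix_diff_ldistrib
        matrix_mul_assoc[symmetric] scalar_matrix_assoc[symmetric] algebra_simps)
  then have "update X F \<gamma> \<epsilon> P = matrix_inv (system_mat X \<gamma> \<epsilon> P) ** (system_mat X \<gamma> \<epsilon> P ** ?Q)"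
    by (simp add: update_def)
  also have "\<dots> = ?Q"
    by (simp add: matrix_mul_assoc matrix_inv_inverse[OF invertible_system_mat[OF assms]])
  finally show ?thesis .
qed

lemma weights_pos: "\<epsilon> > 0 \<Longrightarrow> weights \<epsilon> P $ i > 0"
  by (simp add: weights_nth add_nonneg_pos)

text \<open>The starting point \<open>R \<epsilon>\<close> varies with \<epsilon> so that the result
  can be applied repeatedly, to the iterates.\<close>

lemma tendsto_update:
  assumes "\<gamma> > 0" and "(R \<longlongrightarrow> P) (at_right 0)"
  shows "((\<lambda>\<epsilon>. update X F \<gamma> \<epsilon> (R \<epsilon>)) \<longlongrightarrow> dual_update X F \<gamma> (weights 0 P)) (at_right 0)"
proof -
  have "((\<lambda>\<epsilon>. weights \<epsilon> (R \<epsilon>)) \<longlongrightarrow> weights 0 P) (at_right 0)"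
    unfolding weights_def row_eq_nth by (intro tendsto_intros assms)
  then have "((\<lambda>\<epsilon>. dual_update X F \<gamma> (weights \<epsilon> (R \<epsilon>))) \<longlongrightarrow> dual_update X F \<gamma> (weights 0 P))
      (at_right 0)"
    by (intro tendsto_dual_update assms) (simp_all add: weights_nth)
  then show ?thesis
    by (rule Lim_transform_eventually)
      (auto simp: eventually_at_right_less update_eq_dual_update[OF \<open>\<gamma> > 0\<close> weights_pos]
        intro: eventually_mono[OF eventually_at_right_less])
qed

lemma limit_update_eq:
  assumes "\<gamma> > 0"
  shows "limit_update X F \<gamma> P = dual_update X F \<gamma> (weights 0 P)"
  unfolding limit_update_def
  by (intro tendsto_Lim tendsto_update assms) auto

lemma tendsto_update_iterate:
  assumes "\<gamma> > 0"
  shows "((\<lambda>\<epsilon>. (update X F \<gamma> \<epsilon> ^^ m) P) \<longlongrightarrow> (limit_update X F \<gamma> ^^ m) P) (at_right 0)"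
proof (induction m)
  case (Suc m)
  from tendsto_update[OF assms this, of X F] show ?case
    by (simp add: limit_update_eq[OF assms])
qed simp

section \<open>Descent\<close>

text \<open>After multiplication by \<open>2 * norm p\<close> the gap between the two sides is a sum
  of two squares. If \<open>p = 0\<close>, then \<open>q = 0\<close> too, so
  \<open>p \<noteq> q\<close> makes this factor positive.\<close>

lemma row_descent:
  fixes p q y :: "'a::real_inner"
  assumes q: "q = (2 * norm p) *\<^sub>R y"
  shows "norm q + 2 * ((p - q) \<bullet> y) \<le> norm p"
    and "p \<noteq> q \<Longrightarrow> norm q + 2 * ((p - q) \<bullet> y) < norm p"
proof -
  have *: "2 * norm p * (norm p - norm q - 2 * ((p - q) \<bullet> y)) =
      (norm p - norm q)\<^sup>2 + (norm (p - q))\<^sup>2"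
  proof -
    have "2 * norm p * ((p - q) \<bullet> y) = (p - q) \<bullet> q" by (simp add: q)
    moreover have "(norm (p - q))\<^sup>2 = (norm p)\<^sup>2 - 2 * (p \<bullet> q) + (norm q)\<^sup>2"
      by (simp add: power2_norm_eq_inner algebra_simps inner_commute)
    moreover have "(p - q) \<bullet> q = p \<bullet> q - (norm q)\<^sup>2"
      by (simp add: power2_norm_eq_inner algebra_simps)
    ultimately show ?thesis by (simp add: algebra_simps power2_eq_square)
  qed
  have strict: "norm q + 2 * ((p - q) \<bullet> y) < norm p" if "p \<noteq> q"
  proof -
    have "p \<noteq> 0" using that q by auto
    moreover have "0 < 2 * norm p * (norm p - norm q - 2 * ((p - q) \<bullet> y))"
      unfolding * using that by (simp add: add_nonneg_pos)
    ultimately show ?thesis by (simp add: zero_less_mult_iff)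
  qed
  then show "p \<noteq> q \<Longrightarrow> norm q + 2 * ((p - q) \<bullet> y) < norm p" .
  from strict show "norm q + 2 * ((p - q) \<bullet> y) \<le> norm p" by (cases "p = q") auto
qed

text \<open>Expanding the square around \<open>Q\<close> produces the cross term
  \<open>- 2 * \<gamma> * ((P - Q) \<bullet> Y)\<close> by stationarity. The summed row estimates,
  scaled by \<gamma>, contain the same term with the opposite sign, so the two cancel.\<close>

lemma objective_limit_update_less:
  assumes "\<gamma> > 0" and "limit_update X F \<gamma> P \<noteq> P"
  shows "objective X F \<gamma> (limit_update X F \<gamma> P) < objective X F \<gamma> P"
proof -
  define Q where "Q = limit_update X F \<gamma> P"
  obtain Y where Y: "Q = diag_mat (weights 0 P) ** Y" "transpose X ** (F - X ** Q) = \<gamma> *\<^sub>R Y"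
    using dual_update_stationary[of \<gamma> "weights 0 P" X F] assms(1)
    by (auto simp: Q_def limit_update_eq weights_nth)
  have row: "Q $ i = (2 * norm (P $ i)) *\<^sub>R Y $ i" for i
    by (simp add: Y(1) weights_nth)
  obtain k where "P $ k \<noteq> Q $ k" using assms(2) unfolding Q_def by (metis vec_eq_iff)
  \<comment> \<open>Every row gives the weak estimate; row \<open>k\<close>, which moves, gives the
    strict one.\<close>
  then have "(\<Sum>i\<in>UNIV. norm (Q $ i) + 2 * ((P $ i - Q $ i) \<bullet> Y $ i)) < (\<Sum>i\<in>UNIV. norm (P $ i))"
    by (intro sum_strict_mono_ex1) (auto intro: row_descent[OF row])
  then have l21: "l21_norm Q + 2 * ((P - Q) \<bullet> Y) < l21_norm P"
    by (simp add: l21_norm_def row_eq_nth inner_vec_def[of "P - Q"] sum.distrib sum_distrib_left)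
  have split: "X ** P - F = X ** (P - Q) - (F - X ** Q)"
    by (simp add: matrix_diff_ldistrib)
  have "(X ** (P - Q)) \<bullet> (F - X ** Q) = \<gamma> * ((P - Q) \<bullet> Y)"
    by (simp add: inner_matrix_mult Y(2))
  then have "(norm (X ** P - F))\<^sup>2 =
      (norm (X ** (P - Q)))\<^sup>2 - 2 * \<gamma> * ((P - Q) \<bullet> Y) + (norm (X ** Q - F))\<^sup>2"
    unfolding split norm_minus_commute[of "X ** Q" F]
    by (simp add: power2_norm_eq_inner[of "_ - _"] power2_norm_eq_inner[of "_ ** _"]
        inner_diff_left[of "X ** (P - Q)"] inner_diff_right[of _ "X ** (P - Q)"]
        inner_commute[of "F - X ** Q" "X ** (P - Q)"])
  moreover have "\<gamma> * l21_norm Q + 2 * \<gamma> * ((P - Q) \<bullet> Y) < \<gamma> * l21_norm P"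
    using mult_strict_left_mono[OF l21 \<open>\<gamma> > 0\<close>] by (simp add: algebra_simps)
  ultimately show ?thesis
    using zero_le_power2[of "norm (X ** (P - Q))"]
    unfolding objective_def Q_def[symmetric] by linarith
qed

lemma objective_limit_update_le:
  assumes "\<gamma> > 0"
  shows "objective X F \<gamma> (limit_update X F \<gamma> P) \<le> objective X F \<gamma> P"
  using objective_limit_update_less[OF assms, of X F P] by fastforce

section \<open>Transfer of descent to small positive \<epsilon>\<close>

lemma tendsto_objective:
  assumes "(R \<longlongrightarrow> P) G"
  shows "((\<lambda>x. objective X F \<gamma> (R x)) \<longlongrightarrow> objective X F \<gamma> P) G"
  unfolding objective_def l21_norm_def row_eq_nth by (intro tendsto_intros assms)

text \<open>A strict inequality between limits persists for all small \<epsilon> > 0, and finitely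
  many such conditions hold simultaneously. The assumption \<open>moving\<close> supplies
  strictness; at a fixed point of the limit update, a positive \<epsilon> can raise the
  objective.\<close>

lemma eventually_objective_iterates_decreasing:
  assumes "\<gamma> > 0"
    and moving: "\<forall>m<n. (limit_update X F \<gamma> ^^ Suc m) P \<noteq> (limit_update X F \<gamma> ^^ m) P"
  shows "\<forall>\<^sub>F \<epsilon> in at_right 0. \<forall>m<n. objective X F \<gamma> ((update X F \<gamma> \<epsilon> ^^ Suc m) P)
    \<le> objective X F \<gamma> ((update X F \<gamma> \<epsilon> ^^ m) P)"
proof -
  let ?u = "\<lambda>\<epsilon> m. objective X F \<gamma> ((update X F \<gamma> \<epsilon> ^^ m) P)"
  let ?l = "\<lambda>m. objective X F \<gamma> ((limit_update X F \<gamma> ^^ m) P)"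
  have "\<forall>\<^sub>F \<epsilon> in at_right 0. ?u \<epsilon> (Suc m) < ?u \<epsilon> m" if "m < n" for m
  proof -
    have "((\<lambda>\<epsilon>. ?u \<epsilon> (Suc m) - ?u \<epsilon> m) \<longlongrightarrow> ?l (Suc m) - ?l m) (at_right 0)"
      by (intro tendsto_diff tendsto_objective tendsto_update_iterate assms(1))
    moreover have "?l (Suc m) - ?l m < 0"
      using objective_limit_update_less[OF assms(1), of X F "(limit_update X F \<gamma> ^^ m) P"]
        moving that by simp
    ultimately have "\<forall>\<^sub>F \<epsilon> in at_right 0. ?u \<epsilon> (Suc m) - ?u \<epsilon> m < 0"
      by (rule order_tendstoD(2))
    then show ?thesis by simp
  qed
  then have "\<forall>\<^sub>F \<epsilon> in at_right 0. \<forall>m\<in>{..<n}. objective X F \<gamma> ((update X F \<gamma> \<epsilon> ^^ Suc m) P)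
    < objective X F \<gamma> ((update X F \<gamma> \<epsilon> ^^ m) P)"
    by (intro eventually_ball_finite) auto
  then show ?thesis by eventually_elim (auto intro: less_imp_le)
qed

text \<open>The invertibility clauses ensure that \<open>matrix_inv\<close> denotes a genuine
  inverse, and the convergence clause that \<open>Lim\<close> denotes an actual limit. The threshold
  in the last clause may depend on \<open>P\<close> and \<open>n\<close>.\<close>

theorem theorem2:
  fixes X :: "real^'d^'n" and F :: "real^'k^'n" and \<gamma> :: real and P :: "real^'k^'d"
  assumes "\<gamma> > 0"
  shows "(\<forall>\<epsilon>>0. invertible (system_mat X \<gamma> \<epsilon> P)) \<and>
    ((\<lambda>\<epsilon>. update X F \<gamma> \<epsilon> P) \<longlongrightarrow> limit_update X F \<gamma> P) (at_right 0) \<and>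
    objective X F \<gamma> (limit_update X F \<gamma> P) \<le> objective X F \<gamma> P \<and>
    ((\<forall>i. row i P \<noteq> 0) \<longrightarrow>
       invertible (system_mat X \<gamma> 0 P) \<and>
       limit_update X F \<gamma> P = update X F \<gamma> 0 P \<and>
       objective X F \<gamma> (update X F \<gamma> 0 P) \<le> objective X F \<gamma> P) \<and>
    (\<forall>n. (\<forall>m<n. (limit_update X F \<gamma> ^^ Suc m) P \<noteq> (limit_update X F \<gamma> ^^ m) P) \<longrightarrow>
       (\<exists>\<epsilon>\<^sub>0>0. \<forall>\<epsilon>. 0 < \<epsilon> \<and> \<epsilon> < \<epsilon>\<^sub>0 \<longrightarrow>
          (\<forall>m<n. objective X F \<gamma> ((update X F \<gamma> \<epsilon> ^^ Suc m) P)
                  \<le> objective X F \<gamma> ((update X F \<gamma> \<epsilon> ^^ m) P))))"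
proof (intro conjI allI impI)
  show "invertible (system_mat X \<gamma> \<epsilon> P)" if "\<epsilon> > 0" for \<epsilon>
    using invertible_system_mat[OF assms weights_pos[OF that]] .
  show "((\<lambda>\<epsilon>. update X F \<gamma> \<epsilon> P) \<longlongrightarrow> limit_update X F \<gamma> P) (at_right 0)"
    using tendsto_update_iterate[OF assms, where m=1] by simp
  show descent: "objective X F \<gamma> (limit_update X F \<gamma> P) \<le> objective X F \<gamma> P"
    by (rule objective_limit_update_le[OF assms])
  assume "\<forall>i. row i P \<noteq> 0"
  then have pos: "weights 0 P $ i > 0" for i by (simp add: weights_nth row_eq_nth)
  show "invertible (system_mat X \<gamma> 0 P)"
    by (rule invertible_system_mat[OF assms pos])
  show eq: "limit_update X F \<gamma> P = update X F \<gamma> 0 P"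
    by (simp add: limit_update_eq[OF assms] update_eq_dual_update[OF assms pos])
  show "objective X F \<gamma> (update X F \<gamma> 0 P) \<le> objective X F \<gamma> P"
    using descent unfolding eq .
next
  fix n
  assume "\<forall>m<n. (limit_update X F \<gamma> ^^ Suc m) P \<noteq> (limit_update X F \<gamma> ^^ m) P"
  from eventually_objective_iterates_decreasing[OF assms this]
  show "\<exists>\<epsilon>\<^sub>0>0. \<forall>\<epsilon>. 0 < \<epsilon> \<and> \<epsilon> < \<epsilon>\<^sub>0 \<longrightarrow>
      (\<forall>m<n. objective X F \<gamma> ((update X F \<gamma> \<epsilon> ^^ Suc m) P)
        \<le> objective X F \<gamma> ((update X F \<gamma> \<epsilon> ^^ m) P))"
    unfolding eventually_at_right_field by blast
qed

end
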